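(* An $\mathbf{IL}_{\mathrm{set}}$-frame $F=\langle W,R,S\rangle$ is an $\mathbf{IL}_{\mathrm{set}}\mathsf{R}$-frame if and only if $F\models\mathsf R$, where $\mathsf R$ is the schema $(A\rhd B)\rightarrow\bigl(\neg(A\rhd\neg C)\rhd(B\wedge\Box C)\bigr)$.
   Context: Modal formulas are built from $\bot$ and countably many propositional variables using $\rightarrow$, the unary modality $\Box$ and the binary modality $\rhd$; other boolean connectives are defined as usual and $\Diamond A:=\neg\Box\neg A$. An $\mathbf{IL}_{\mathrm{set}}$-frame is a structure $\langle W,R,S\rangle$ where $W$ is a non-empty set, $R$ is a transitive and conversely well-founded binary relation on $W$ (every non-empty subset of $W$ has an $R$-maximal element), and $S\subseteq W\times W\times(\mathcal P(W)\setminus\{\emptyset\})$ satisfies, writing $yS_xY$ for $(x,y,Y)\in S$: (a) if $xS_wY$ then $wRx$ and $wRy$ for all $y\in Y$; (b) $wRx$ implies $xS_w\{x\}$; (c) if $xS_wY$, then for all $y\in Y$ and all $Z$: if $y\notin Z$ and $yS_wZ$ then $xS_wZ$; (d) $wRx$ and $xRy$ imply $xS_w\{y\}$. An $\mathbf{IL}_{\mathrm{set}}$-model based on such a frame is obtained by adding a relation $\Vdash$ between worlds and formulas that commutes with boolean connectives and satisfies: $w\Vdash\Box A$ iff $x\Vdash A$ for all $x$ with $wRx$; $w\Vdash A\rhd B$ iff for all $x$ with $wRx$ and $x\Vdash A$ there is $Y$ with $xS_wY$ and $y\Vdash B$ for all $y\in Y$. For a schema $\mathsf X$, $F\models\mathsf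 X$ means that every instance of $\mathsf X$ is true at every world of every model based on $F$. For $wRx$, a set $\Gamma\subseteq W$ is a choice set for $(w,x)$ if $X\cap\Gamma\neq\emptyset$ for every $X$ with $xS_wX$. An $\mathbf{IL}_{\mathrm{set}}\mathsf R$-frame is an $\mathbf{IL}_{\mathrm{set}}$-frame such that for all $w,x,y\in W$ and $Y\subseteq W$ with $wRx$, $xRy$ and $yS_wY$, and every choice set $\Gamma$ for $(x,y)$, there exists $Y'\subseteq Y$ such that $xS_wY'$ and, for all $y'\in Y'$ and all $z$, $y'Rz$ implies $z\in\Gamma$. *)

theory Defs
  imports Main
begin

datatype form =
    Bot
  | Var nat
  | Imp form form
  | Box form
  | Rhd form form

definition Neg :: "form \<Rightarrow> form" where
  "Neg A = Imp A Bot"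

definition Conj :: "form \<Rightarrow> form \<Rightarrow> form" where
  "Conj A B = Neg (Imp A (Neg B))"

(* Instances of the schema R: (A |> B) -> (~(A |> ~C) |> (B & Box C)). *)
definition schema_R :: "form set" where
  "schema_R = {Imp (Rhd A B) (Rhd (Neg (Rhd A (Neg C))) (Conj B (Box C))) | A B C. True}"

(* The triple (w, x, X) in srel F is written  x S_w X  on paper: the index of S comes first. *)
record 'a frame =
  worlds :: "'a set"
  acc :: "('a \<times> 'a) set"
  srel :: "('a \<times> 'a \<times> 'a set) set"

definition conversely_wf_on :: "'a set \<Rightarrow> ('a \<times> 'a) set \<Rightarrow> bool" where
  "conversely_wf_on W R \<longleftrightarrow>
     (\<forall>X. X \<subseteq> W \<and> X \<noteq> {} \<longrightarrow> (\<exists>m\<in>X. \<forall>x\<in>X. (m, x) \<notin> R))"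

definition ILset_frame :: "'a frame \<Rightarrow> bool" where
  "ILset_frame F \<longleftrightarrow>
     worlds F \<noteq> {} \<and>
     acc F \<subseteq> worlds F \<times> worlds F \<and>
     trans (acc F) \<and>
     conversely_wf_on (worlds F) (acc F) \<and>
     srel F \<subseteq> worlds F \<times> worlds F \<times> (Pow (worlds F) - {{}}) \<and>
     (\<forall>w x Y. (w, x, Y) \<in> srel F \<longrightarrow> (w, x) \<in> acc F \<and> (\<forall>y\<in>Y. (w, y) \<in> acc F)) \<and>
     (\<forall>w x. (w, x) \<in> acc F \<longrightarrow> (w, x, {x}) \<in> srel F) \<and>
     (\<forall>w x Y. (w, x, Y) \<in> srel F \<longrightarrow>
        (\<forall>y\<in>Y. \<forall>Z. y \<notin> Z \<and> (w, y, Z) \<in> srel F \<longrightarrow> (w, x, Z) \<in> srel F)) \<and>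
     (\<forall>w x y. (w, x) \<in> acc F \<and> (x, y) \<in> acc F \<longrightarrow> (w, x, {y}) \<in> srel F)"

(* forces is a forcing relation on F: a relation between worlds of F and formulas obeying the
   clauses for the primitive connectives; its values on propositional variables are free. *)
definition ILset_model :: "'a frame \<Rightarrow> ('a \<Rightarrow> form \<Rightarrow> bool) \<Rightarrow> bool" where
  "ILset_model F forces \<longleftrightarrow>
     (\<forall>w A. forces w A \<longrightarrow> w \<in> worlds F) \<and>
     (\<forall>w\<in>worlds F.
        \<not> forces w Bot \<and>
        (\<forall>A B. forces w (Imp A B) \<longleftrightarrow> (forces w A \<longrightarrow> forces w B)) \<and>
        (\<forall>A. forces w (Box A) \<longleftrightarrow> (\<forall>x. (w, x) \<in> acc F \<longrightarrow> forces x A)) \<and>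
        (\<forall>A B. forces w (Rhd A B) \<longleftrightarrow>
           (\<forall>x. (w, x) \<in> acc F \<and> forces x A \<longrightarrow>
              (\<exists>Y. (w, x, Y) \<in> srel F \<and> (\<forall>y\<in>Y. forces y B)))))"

(* A schema is represented by the set of its instances. *)
definition frame_valid :: "'a frame \<Rightarrow> form set \<Rightarrow> bool" where
  "frame_valid F X \<longleftrightarrow>
     (\<forall>forces. ILset_model F forces \<longrightarrow> (\<forall>A\<in>X. \<forall>w\<in>worlds F. forces w A))"

definition choice_set :: "'a frame \<Rightarrow> 'a \<Rightarrow> 'a \<Rightarrow> 'a set \<Rightarrow> bool" where
  "choice_set F w x \<Gamma> \<longleftrightarrow>
     (w, x) \<in> acc F \<and> \<Gamma> \<subseteq> worlds F \<and> (\<forall>X. (w, x, X) \<in> srel F \<longrightarrow> X \<inter> \<Gamma> \<noteq> {})"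

definition ILsetR_frame :: "'a frame \<Rightarrow> bool" where
  "ILsetR_frame F \<longleftrightarrow>
     ILset_frame F \<and>
     (\<forall>w\<in>worlds F. \<forall>x\<in>worlds F. \<forall>y\<in>worlds F. \<forall>Y\<subseteq>worlds F.
        (w, x) \<in> acc F \<and> (x, y) \<in> acc F \<and> (w, y, Y) \<in> srel F \<longrightarrow>
        (\<forall>\<Gamma>. choice_set F x y \<Gamma> \<longrightarrow>
           (\<exists>Y'\<subseteq>Y. (w, x, Y') \<in> srel F \<and>
              (\<forall>y'\<in>Y'. \<forall>z. (y', z) \<in> acc F \<longrightarrow> z \<in> \<Gamma>))))"

end

theory Submission
  imports Defs
begin

text \<open>
  A choice set \<open>\<Gamma>\<close> for \<open>(x, y)\<close> is what the truth set of \<open>C\<close> becomes when \<open>y\<close> witnesses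
  \<open>x \<tturnstile> \<not>(A \<rhd> \<not>C)\<close>. Conversely, interpreting three variables as \<open>{y}\<close>, \<open>Y\<close> and \<open>\<Gamma>\<close> turns
  the corresponding instance of the schema into the frame condition.
\<close>

text \<open>Refuting the frame condition through validity needs a forcing relation with prescribed
  values on variables; recursion on formulas extends any valuation \<open>V\<close> to one.
  Membership in \<open>worlds F\<close> is left out here and imposed afterwards.\<close>

primrec sat :: "'a frame \<Rightarrow> (nat \<Rightarrow> 'a set) \<Rightarrow> form \<Rightarrow> 'a \<Rightarrow> bool" where
  "sat F V Bot w \<longleftrightarrow> False"
| "sat F V (Var n) w \<longleftrightarrow> w \<in> V n"
| "sat F V (Imp A B) w \<longleftrightarrow> (sat F V A w \<longrightarrow> sat F V B w)"
| "sat F V (Box A) w \<longleftrightarrow> (\<forall>x. (w, x) \<in> acc F \<longrightarrow> sat F V A x)"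
| "sat F V (Rhd A B) w \<longleftrightarrow>
     (\<forall>x. (w, x) \<in> acc F \<and> sat F V A x \<longrightarrow>
        (\<exists>Y. (w, x, Y) \<in> srel F \<and> (\<forall>y\<in>Y. sat F V B y)))"

lemma ILset_frame_accD:
  assumes "ILset_frame F" "(w, x) \<in> acc F"
  shows "w \<in> worlds F" "x \<in> worlds F"
proof -
  have "acc F \<subseteq> worlds F \<times> worlds F"
    using assms(1) by (simp only: ILset_frame_def)
  with assms(2) show "w \<in> worlds F" "x \<in> worlds F"
    by blast+
qed

lemma ILset_frame_acc_trans:
  assumes "ILset_frame F" "(w, x) \<in> acc F" "(x, y) \<in> acc F"
  shows "(w, y) \<in> acc F"
proof -
  have "trans (acc F)"
    using assms(1) by (simp only: ILset_frame_def)
  then show ?thesis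
    using assms(2,3) by (rule transD)
qed

lemma ILset_frame_srel_subset:
  assumes "ILset_frame F" "(w, x, Y) \<in> srel F"
  shows "Y \<subseteq> worlds F"
proof -
  have "srel F \<subseteq> worlds F \<times> worlds F \<times> (Pow (worlds F) - {{}})"
    using assms(1) by (simp only: ILset_frame_def)
  with assms(2) show ?thesis
    by blast
qed

text \<open>Cutting \<open>sat\<close> down to worlds disturbs no clause, because
  \<open>acc F\<close> and the sets in \<open>srel F\<close> never leave
  \<open>worlds F\<close>.\<close>

lemma ILset_model_sat:
  assumes "ILset_frame F"
  shows "ILset_model F (\<lambda>w A. w \<in> worlds F \<and> sat F V A w)"
proof -
  have "sat F V (Box A) w \<longleftrightarrow> (\<forall>x. (w, x) \<in> acc F \<longrightarrow> x \<in> worlds F \<and> sat F V A x)" for w A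
    using ILset_frame_accD[OF assms] by auto
  moreover have "(w, x) \<in> acc F \<and> x \<in> worlds F \<and> P \<longleftrightarrow> (w, x) \<in> acc F \<and> P" for w x P
    using ILset_frame_accD[OF assms] by blast
  moreover have "(w, x, Y) \<in> srel F \<and> (\<forall>y\<in>Y. y \<in> worlds F \<and> sat F V B y) \<longleftrightarrow>
      (w, x, Y) \<in> srel F \<and> (\<forall>y\<in>Y. sat F V B y)" for w x Y B
    using ILset_frame_srel_subset[OF assms] by blast
  \<comment> \<open>The world-restricted \<open>Box\<close> equation replaces
    \<open>sat.simps(4)\<close>, which would rewrite to the unrestricted form.\<close>
  ultimately show ?thesis
    by (simp add: ILset_model_def del: sat.simps(4))
qed

context
  fixes F :: "'a frame" and forces :: "'a \<Rightarrow> form \<Rightarrow> bool"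
  assumes model: "ILset_model F forces"
begin

lemma forces_world: "forces w A \<Longrightarrow> w \<in> worlds F"
  using model by (auto simp: ILset_model_def)

lemma forces_Imp:
  "w \<in> worlds F \<Longrightarrow> forces w (Imp A B) \<longleftrightarrow> (forces w A \<longrightarrow> forces w B)"
  using model by (auto simp: ILset_model_def)

lemma forces_Neg: "w \<in> worlds F \<Longrightarrow> forces w (Neg A) \<longleftrightarrow> \<not> forces w A"
  using model by (auto simp: ILset_model_def Neg_def)

text \<open>Unlike negation, conjunction needs no world hypothesis: outside \<open>worlds F\<close>
  nothing is forced, so both sides are false.\<close>

lemma forces_Conj: "forces w (Conj A B) \<longleftrightarrow> forces w A \<and> forces w B"
  using forces_world by (cases "w \<in> worlds F") (auto simp: Conj_def forces_Neg forces_Imp)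

lemma forces_Box:
  "w \<in> worlds F \<Longrightarrow> forces w (Box A) \<longleftrightarrow> (\<forall>x. (w, x) \<in> acc F \<longrightarrow> forces x A)"
  using model by (auto simp: ILset_model_def)

lemma forces_Rhd:
  "w \<in> worlds F \<Longrightarrow> forces w (Rhd A B) \<longleftrightarrow>
     (\<forall>x. (w, x) \<in> acc F \<and> forces x A \<longrightarrow>
        (\<exists>Y. (w, x, Y) \<in> srel F \<and> (\<forall>y\<in>Y. forces y B)))"
  using model by (simp add: ILset_model_def)

end

lemma frame_valid_schema_R_if_ILsetR_frame:
  assumes "ILsetR_frame F"
  shows "frame_valid F schema_R"
proof -
  have frame: "ILset_frame F"
    and R_cond: "\<And>w x y Y \<Gamma>. w \<in> worlds F \<Longrightarrow> x \<in> worlds F \<Longrightarrow> y \<in> worlds F \<Longrightarrow> Y \<subseteq> worlds F \<Longrightarrow>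
      (w, x) \<in> acc F \<and> (x, y) \<in> acc F \<and> (w, y, Y) \<in> srel F \<Longrightarrow> choice_set F x y \<Gamma> \<Longrightarrow>
      \<exists>Y'\<subseteq>Y. (w, x, Y') \<in> srel F \<and> (\<forall>y'\<in>Y'. \<forall>z. (y', z) \<in> acc F \<longrightarrow> z \<in> \<Gamma>)"
    using assms unfolding ILsetR_frame_def by simp_all
  have "forces w (Rhd (Neg (Rhd A (Neg C))) (Conj B (Box C)))"
    if model: "ILset_model F forces" and w: "w \<in> worlds F" and AB: "forces w (Rhd A B)"
    for forces w A B C
    unfolding forces_Rhd[OF model w]
  proof (intro allI impI)
    fix x
    assume x: "(w, x) \<in> acc F \<and> forces x (Neg (Rhd A (Neg C)))"
    then have xW: "x \<in> worlds F"
      using ILset_frame_accD[OF frame] by blast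
    with x have "\<not> forces x (Rhd A (Neg C))"
      using forces_Neg[OF model] by blast
    then obtain y where y: "(x, y) \<in> acc F" "forces y A"
      and neg: "\<And>X. (x, y, X) \<in> srel F \<Longrightarrow> \<exists>u\<in>X. \<not> forces u (Neg C)"
      unfolding forces_Rhd[OF model xW] by blast
    \<comment> \<open>Each \<open>X\<close> contains a world refuting \<open>Neg C\<close>, hence
      forcing \<open>C\<close>.\<close>
    have choice: "choice_set F x y {u. forces u C}"
      unfolding choice_set_def
    proof (intro conjI allI impI)
      show "{u. forces u C} \<subseteq> worlds F"
        using forces_world[OF model] by blast
      show "X \<inter> {u. forces u C} \<noteq> {}" if "(x, y, X) \<in> srel F" for X
        using neg[OF that] forces_Neg[OF model] ILset_frame_srel_subset[OF frame that] by blast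
    qed (fact y)
    \<comment> \<open>Transitivity lets \<open>A \<rhd> B\<close> at \<open>w\<close> be applied to
      \<open>y\<close>, as \<open>x\<close> itself need not force \<open>A\<close>.\<close>
    have "(w, y) \<in> acc F"
      using ILset_frame_acc_trans[OF frame] x y by blast
    then obtain Y where Y: "(w, y, Y) \<in> srel F" "\<forall>u\<in>Y. forces u B"
      using AB y(2) unfolding forces_Rhd[OF model w] by blast
    have YW: "Y \<subseteq> worlds F" and yW: "y \<in> worlds F"
      using ILset_frame_srel_subset[OF frame Y(1)] ILset_frame_accD[OF frame y(1)] by auto
    obtain Y' where Y': "Y' \<subseteq> Y" "(w, x, Y') \<in> srel F"
      "\<forall>y'\<in>Y'. \<forall>z. (y', z) \<in> acc F \<longrightarrow> z \<in> {u. forces u C}"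
      using R_cond[OF w xW yW YW _ choice] x y(1) Y(1) by blast
    \<comment> \<open>\<open>B\<close> is inherited from \<open>Y\<close>, and \<open>Box C\<close>
      holds because all successors of \<open>y'\<close> lie in the choice set.\<close>
    have "forces y' (Conj B (Box C))" if "y' \<in> Y'" for y'
      using that Y' Y(2) YW by (auto simp: forces_Conj[OF model] forces_Box[OF model])
    with Y'(2) show "\<exists>Y. (w, x, Y) \<in> srel F \<and> (\<forall>y\<in>Y. forces y (Conj B (Box C)))"
      by blast
  qed
  then show ?thesis
    by (auto simp: frame_valid_def schema_R_def forces_Imp)
qed

lemma ILsetR_frame_if_frame_valid_schema_R:
  assumes frame: "ILset_frame F" and valid: "frame_valid F schema_R"
  shows "ILsetR_frame F"
  unfolding ILsetR_frame_def
proof (intro conjI ballI allI impI)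
  fix w x y Y \<Gamma>
  assume w: "w \<in> worlds F" and x: "x \<in> worlds F" and y: "y \<in> worlds F"
    and wxyY: "(w, x) \<in> acc F \<and> (x, y) \<in> acc F \<and> (w, y, Y) \<in> srel F"
    and choice: "choice_set F x y \<Gamma>"
  define V where "V n = (if n = 0 then {y} else if n = 1 then Y else \<Gamma>)" for n :: nat
  let ?p = "Var 0" and ?q = "Var 1" and ?r = "Var 2"
  let ?forces = "\<lambda>w A. w \<in> worlds F \<and> sat F V A w"
  have model: "ILset_model F ?forces"
    by (rule ILset_model_sat[OF frame])
  have "Imp (Rhd ?p ?q) (Rhd (Neg (Rhd ?p (Neg ?r))) (Conj ?q (Box ?r))) \<in> schema_R"
    by (auto simp: schema_R_def)
  from valid[unfolded frame_valid_def, rule_format, OF model this w]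
  have inst: "sat F V (Imp (Rhd ?p ?q) (Rhd (Neg (Rhd ?p (Neg ?r))) (Conj ?q (Box ?r)))) w"
    by (rule conjunct2)
  \<comment> \<open>Since \<open>?p\<close> is true only at \<open>y\<close>, the single obligation
    is met by \<open>Y\<close>, the truth set of \<open>?q\<close>.\<close>
  have "sat F V (Rhd ?p ?q) w"
    using wxyY by (auto simp: V_def)
  with inst have "sat F V (Rhd (Neg (Rhd ?p (Neg ?r))) (Conj ?q (Box ?r))) w"
    by (simp only: sat.simps(3))
  \<comment> \<open>The successor \<open>y\<close> of \<open>x\<close> is the counterexample: any
    \<open>X\<close> with \<open>(x, y, X)\<close> in \<open>srel F\<close> meets \<Gamma>, so
    \<open>Neg ?r\<close> fails somewhere in it.\<close>
  moreover have "sat F V (Neg (Rhd ?p (Neg ?r))) x"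
  proof -
    have "\<exists>u\<in>X. u \<in> \<Gamma>" if "(x, y, X) \<in> srel F" for X
      using choice that unfolding choice_set_def by blast
    with wxyY show ?thesis
      by (auto simp: V_def Neg_def)
  qed
  ultimately obtain Y' where Y': "(w, x, Y') \<in> srel F" "\<forall>u\<in>Y'. sat F V (Conj ?q (Box ?r)) u"
    using wxyY unfolding sat.simps(5) by blast
  \<comment> \<open>Read through \<open>V\<close>, the conjunct \<open>?q\<close> gives
    \<open>Y' \<subseteq> Y\<close>, and \<open>Box ?r\<close> puts the successors of
    \<open>Y'\<close> into \<Gamma>.\<close>
  then show "\<exists>Y'\<subseteq>Y. (w, x, Y') \<in> srel F \<and> (\<forall>y'\<in>Y'. \<forall>z. (y', z) \<in> acc F \<longrightarrow> z \<in> \<Gamma>)"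
    by (intro exI[of _ Y']) (auto simp: Conj_def Neg_def V_def)
qed (fact frame)

theorem lemma3p14:
  fixes F :: "'a frame"
  assumes "ILset_frame F"
  shows "ILsetR_frame F \<longleftrightarrow> frame_valid F schema_R"
  using assms frame_valid_schema_R_if_ILsetR_frame ILsetR_frame_if_frame_valid_schema_R by blast

end
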